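(* Let $a,c,t$ be integers with $a,t\geq 2$ and $a>c\geq 1$, and suppose $(a-1)(c-1)<t-1$. Then the graph $G_{a,c,t}$ (constructed as in the context) is an extremal $(a(t-1)\,|\,t+c-1)$-graph: it is $a(t-1)$-regular with chromatic number $t+c-1$, and every $a(t-1)$-regular graph with chromatic number $t+c-1$ has at least $at$ vertices.
   Context: An $(r|\chi)$-graph is a simple finite $r$-regular graph with chromatic number $\chi$; it is extremal if it has minimum order among all $(r|\chi)$-graphs. Construction of $G_{a,c,t}$: start from the complete $t$-partite graph with parts $V_1,\dots,V_t$, each of size $a$. Choose $c$ vertices $u_1,\dots,u_c\in V_1$ and $c$ vertices $v_1,\dots,v_c\in V_2$. Remove all edges $u_iv_j$ with $i\neq j$ ($i,j\in\{1,\dots,c\}$), keeping the matching $u_iv_i$, and add all edges $u_iu_j$ and $v_iv_j$ with $i\neq j$ ($i,j\in\{1,\dots,c\}$). *)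

theory Defs
  imports "Graph_Theory.Pair_Digraph"
begin

text \<open>
  A simple finite graph is a \<^locale>\<open>pair_graph\<close>: a finite, loop-free, symmetric relation on
  its vertices, the undirected edge \<open>xy\<close> being the two arcs \<open>(x, y)\<close> and \<open>(y, x)\<close>. The degree of
  a vertex is therefore its out-degree.
\<close>

definition regular_graph :: "nat \<Rightarrow> 'a pair_pre_digraph \<Rightarrow> bool" where
  "regular_graph r G \<longleftrightarrow> (\<forall>x \<in> pverts G. out_degree (with_proj G) x = r)"

definition proper_coloring :: "'a pair_pre_digraph \<Rightarrow> nat \<Rightarrow> ('a \<Rightarrow> nat) \<Rightarrow> bool" where
  "proper_coloring G k f \<longleftrightarrow>
     (\<forall>x \<in> pverts G. f x < k) \<and> (\<forall>(x, y) \<in> parcs G. f x \<noteq> f y)"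

definition chromatic_number :: "'a pair_pre_digraph \<Rightarrow> nat" where
  "chromatic_number G = (LEAST k. \<exists>f. proper_coloring G k f)"

text \<open>The minimum above is over a nonempty set, so it is never an unspecified value:\<close>

lemma ex_proper_coloring:
  assumes "pair_graph G"
  shows "\<exists>k f. proper_coloring G k f"
proof -
  interpret pair_graph G by fact
  obtain f :: "'a \<Rightarrow> nat" where f: "inj_on f (pverts G)"
    using finite_imp_inj_to_nat_seg[OF pair_finite_verts] by blast
  have "proper_coloring G (Suc (Max (f ` pverts G))) f"
    unfolding proper_coloring_def
  proof (intro conjI ballI)
    show "f x < Suc (Max (f ` pverts G))" if "x \<in> pverts G" for x
      using that pair_finite_verts by (simp add: less_Suc_eq_le)
    show "case e of (x, y) \<Rightarrow> f x \<noteq> f y" if e: "e \<in> parcs G" for e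
    proof (cases e)
      case (Pair x y)
      then have "x \<in> pverts G" "y \<in> pverts G" "x \<noteq> y"
        using e in_arcsD1 in_arcsD2 pair_no_loops[OF e] by auto
      then show ?thesis
        using Pair f by (auto simp: inj_on_def)
    qed
  qed
  then show ?thesis by blast
qed

definition rchi_graph :: "nat \<Rightarrow> nat \<Rightarrow> 'a pair_pre_digraph \<Rightarrow> bool" where
  "rchi_graph r \<chi> G \<longleftrightarrow> pair_graph G \<and> regular_graph r G \<and> chromatic_number G = \<chi>"

text \<open>
  A definition cannot quantify over vertex types. The competitors \<open>H\<close> below have vertices in
  \<^typ>\<open>nat\<close>, which loses nothing since every finite graph is isomorphic to such a graph.
\<close>

definition extremal_rchi_graph :: "nat \<Rightarrow> nat \<Rightarrow> 'a pair_pre_digraph \<Rightarrow> bool" where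
  "extremal_rchi_graph r \<chi> G \<longleftrightarrow>
     rchi_graph r \<chi> G \<and>
     (\<forall>H :: nat pair_pre_digraph. rchi_graph r \<chi> H \<longrightarrow> card (pverts G) \<le> card (pverts H))"

text \<open>
  The complete \<open>t\<close>-partite graph with parts \<open>V\<^sub>p = {p} \<times> {1..a}\<close> for \<open>p = 1, \<dots>, t\<close>.
\<close>

definition complete_multipartite :: "nat \<Rightarrow> nat \<Rightarrow> (nat \<times> nat) pair_pre_digraph" where
  "complete_multipartite a t =
     \<lparr> pverts = {1..t} \<times> {1..a},
       parcs = {(x, y). x \<in> {1..t} \<times> {1..a} \<and> y \<in> {1..t} \<times> {1..a} \<and> fst x \<noteq> fst y} \<rparr>"

text \<open>
  The selected vertices are \<open>u\<^sub>i = (1, i) \<in> V\<^sub>1\<close> and \<open>v\<^sub>i = (2, i) \<in> V\<^sub>2\<close> for \<open>i = 1, \<dots>, c\<close>; up to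
  isomorphism the choice does not matter.
\<close>

definition removed_edges :: "nat \<Rightarrow> (nat \<times> nat) rel" where
  "removed_edges c =
     {((1, i), (2, j)) | i j. i \<in> {1..c} \<and> j \<in> {1..c} \<and> i \<noteq> j} \<union>
     {((2, j), (1, i)) | i j. i \<in> {1..c} \<and> j \<in> {1..c} \<and> i \<noteq> j}"

definition added_edges :: "nat \<Rightarrow> (nat \<times> nat) rel" where
  "added_edges c =
     {((1, i), (1, j)) | i j. i \<in> {1..c} \<and> j \<in> {1..c} \<and> i \<noteq> j} \<union>
     {((2, i), (2, j)) | i j. i \<in> {1..c} \<and> j \<in> {1..c} \<and> i \<noteq> j}"

definition G_act :: "nat \<Rightarrow> nat \<Rightarrow> nat \<Rightarrow> (nat \<times> nat) pair_pre_digraph" where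
  "G_act a c t =
     \<lparr> pverts = pverts (complete_multipartite a t),
       parcs = (parcs (complete_multipartite a t) - removed_edges c) \<union> added_edges c \<rparr>"

end

theory Submission
  imports Defs
begin

text \<open>
  In an \<open>r\<close>-regular graph of order \<open>n\<close> a colour class has at most \<open>n - r\<close> vertices, so
  \<open>n \<le> \<chi> (n - r)\<close>. If \<open>r = a (t - 1)\<close> and \<open>n < a t\<close>, then \<open>n - r \<le> a - 1\<close>, which gives
  \<open>a (t - 1) \<le> (\<chi> - 1) (a - 1)\<close>; for \<open>\<chi> = t + c - 1\<close> this contradicts \<open>(a - 1) (c - 1) < t - 1\<close>.

  In \<open>G\<^bsub>a,c,t\<^esub>\<close> every selected vertex loses and gains \<open>c - 1\<close> neighbours. A vertex of
  \<open>V\<^sub>1\<close> that is not selected, the vertices \<open>v\<^sub>1, \<dots>, v\<^sub>c\<close> and one vertex from each of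
  \<open>V\<^sub>3, \<dots>, V\<^sub>t\<close> form a clique of order \<open>t + c - 1\<close>. Conversely \<open>c + 1\<close> colours suffice for
  \<open>V\<^sub>1 \<union> V\<^sub>2\<close>: shift the colours of the \<open>v\<^sub>i\<close> by one against those of the \<open>u\<^sub>i\<close>, which
  leaves the first colour for the rest of \<open>V\<^sub>1\<close> and the last one for the rest of \<open>V\<^sub>2\<close>.
\<close>

lemma out_degree_with_proj:
  "out_degree (with_proj G) x = card {y. (x, y) \<in> parcs G}"
proof -
  have "out_arcs (with_proj G) x = Pair x ` {y. (x, y) \<in> parcs G}"
    by (auto simp: out_arcs_def)
  then show ?thesis
    by (simp add: out_degree_def card_image inj_on_def)
qed

lemma chromatic_number_coloring:
  assumes "pair_graph G"
  obtains f where "proper_coloring G (chromatic_number G) f"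
  using LeastI_ex[OF ex_proper_coloring[OF assms]] unfolding chromatic_number_def by blast

text \<open>A clique of order \<open>k\<close> takes \<open>k\<close> distinct colours, so a
  colouring with \<open>k\<close> colours is optimal.\<close>

lemma chromatic_number_eqI:
  assumes col: "proper_coloring G k f"
    and clique: "K \<subseteq> pverts G" "card K = k"
      "\<And>x y. x \<in> K \<Longrightarrow> y \<in> K \<Longrightarrow> x \<noteq> y \<Longrightarrow> (x, y) \<in> parcs G"
  shows "chromatic_number G = k"
  unfolding chromatic_number_def
proof (rule Least_equality)
  show "\<exists>f. proper_coloring G k f"
    using col by blast
next
  fix l assume "\<exists>g. proper_coloring G l g"
  then obtain g where g: "proper_coloring G l g" by blast
  have "inj_on g K"
    using g clique(3) unfolding proper_coloring_def inj_on_def by blast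
  moreover have "g ` K \<subseteq> {..<l}"
    using g clique(1) unfolding proper_coloring_def by auto
  ultimately show "k \<le> l"
    using card_inj_on_le[of g K "{..<l}"] clique(2) by simp
qed

lemma card_le_coloring_regular:
  assumes G: "pair_graph G" and reg: "regular_graph r G" and col: "proper_coloring G k f"
  shows "card (pverts G) \<le> k * (card (pverts G) - r)"
proof -
  interpret pair_graph G by fact
  define C where "C i = {x \<in> pverts G. f x = i}" for i
  have class_card: "card (C i) \<le> card (pverts G) - r" for i
  proof (cases "C i = {}")
    case False
    then obtain x where x: "x \<in> pverts G" "f x = i" by (auto simp: C_def)
    define N where "N = {y. (x, y) \<in> parcs G}"
    have "card N = r"
      using reg x(1) by (simp add: regular_graph_def out_degree_with_proj N_def)
    moreover have N: "N \<subseteq> pverts G"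
      using in_arcsD2 by (auto simp: N_def)
    \<comment> \<open>A class containing \<open>x\<close> misses all \<open>r\<close> neighbours of
      \<open>x\<close>.\<close>
    moreover have "C i \<subseteq> pverts G - N"
      using col x(2) by (auto simp: C_def N_def proper_coloring_def)
    ultimately show ?thesis
      using card_mono[of "pverts G - N" "C i"] card_Diff_subset[of N "pverts G"]
        finite_subset[OF N] pair_finite_verts by simp
  qed simp
  have "pverts G = (\<Union>i<k. C i)"
    using col by (auto simp: C_def proper_coloring_def)
  then have "card (pverts G) \<le> (\<Sum>i<k. card (C i))"
    using card_UN_le[of "{..<k}" C] by simp
  also have "\<dots> \<le> (\<Sum>i<k. card (pverts G) - r)"
    by (intro sum_mono class_card)
  finally show ?thesis by simp
qed

lemma rchi_graph_order_ge:
  assumes "t \<ge> 2" and "c \<ge> 1" and "(a - 1) * (c - 1) < t - 1"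
    and H: "rchi_graph (a * (t - 1)) (t + c - 1) H"
  shows "a * t \<le> card (pverts H)"
proof (rule ccontr)
  assume less: "\<not> a * t \<le> card (pverts H)"
  define n where "n = card (pverts H)"
  obtain f where f: "proper_coloring H (t + c - 1) f"
    using H chromatic_number_coloring unfolding rchi_graph_def by metis
  have n_le: "n \<le> (t + c - 1) * (n - a * (t - 1))"
    using card_le_coloring_regular[OF _ _ f] H unfolding rchi_graph_def n_def by blast
  obtain s where s: "t = Suc s" using assms(1) by (cases t) auto
  obtain d where d: "c = Suc d" using assms(2) by (cases c) auto
  obtain b where b: "a = Suc b" using less by (cases a) auto
  interpret pair_graph H
    using H by (simp add: rchi_graph_def)
  \<comment> \<open>Truncated subtraction makes \<open>n_le\<close> trivial at \<open>n = 0\<close>,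
    so the empty graph is excluded separately, by its chromatic number 0.\<close>
  have "n \<noteq> 0"
  proof
    assume "n = 0"
    then have "pverts H = {}"
      using pair_finite_verts by (simp add: n_def)
    moreover from this have "parcs H = {}"
      using in_arcsD1 by fastforce
    ultimately have "proper_coloring H 0 f"
      by (simp add: proper_coloring_def)
    then have "chromatic_number H = 0"
      unfolding chromatic_number_def by (intro Least_eq_0) blast
    with H assms(1,2) show False by (simp add: rchi_graph_def)
  qed
  define e where "e = n - a * s"
  \<comment> \<open>If \<open>n \<le> a * s\<close>, the truncated difference vanishes and
    \<open>n_le\<close> forces \<open>n = 0\<close>.\<close>
  have "n = a * s + e"
    using n_le \<open>n \<noteq> 0\<close> by (cases "n \<le> a * s") (auto simp: e_def s)
  moreover have "e \<le> b"
    using less \<open>n = a * s + e\<close> by (simp add: n_def[symmetric] s b)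
  moreover have "n \<le> (s + d + 1) * e"
    using n_le by (simp add: e_def s d)
  ultimately have "a * s \<le> (s + d) * e"
    by (simp add: algebra_simps)
  also have "\<dots> \<le> (s + d) * b"
    using \<open>e \<le> b\<close> by simp
  \<comment> \<open>Since \<open>a = b + 1\<close>, this amounts to \<open>b * d < s\<close>, the
    numerical hypothesis.\<close>
  also have "\<dots> < a * s"
    using assms(3) by (simp add: s d b algebra_simps)
  finally show False by simp
qed

lemma pverts_G_act: "pverts (G_act a c t) = {1..t} \<times> {1..a}"
  by (simp add: G_act_def complete_multipartite_def)

text \<open>Between selected vertices, adjacency is complemented for \<open>i \<noteq> j\<close> and
  kept for \<open>i = j\<close>; \<open>c \<le> a\<close> and \<open>t \<ge> 2\<close> keep the
  added edges inside the vertex set.\<close>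

lemma arc_G_act_iff:
  assumes "c \<le> a" and "t \<ge> 2"
  shows "((p, i), (q, j)) \<in> parcs (G_act a c t) \<longleftrightarrow>
    p \<in> {1..t} \<and> q \<in> {1..t} \<and> i \<in> {1..a} \<and> j \<in> {1..a} \<and>
    (if p \<in> {1, 2} \<and> q \<in> {1, 2} \<and> i \<le> c \<and> j \<le> c then (p = q) = (i \<noteq> j) else p \<noteq> q)"
  using assms
  by (auto simp: G_act_def complete_multipartite_def removed_edges_def added_edges_def)

lemma pair_graph_G_act:
  assumes "c \<le> a" and "t \<ge> 2"
  shows "pair_graph (G_act a c t)"
proof
  show "finite (pverts (G_act a c t))"
    by (simp add: pverts_G_act)
  have "parcs (G_act a c t) \<subseteq> pverts (G_act a c t) \<times> pverts (G_act a c t)"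
    using arc_G_act_iff[OF assms] by (auto simp: pverts_G_act)
  then show "finite (parcs (G_act a c t))"
    by (rule finite_subset) (simp add: pverts_G_act)
  show "fst e \<in> pverts (G_act a c t)" "snd e \<in> pverts (G_act a c t)" "fst e \<noteq> snd e"
    if "e \<in> parcs (G_act a c t)" for e
    using that arc_G_act_iff[OF assms]
    by (cases e; cases "fst e"; cases "snd e"; auto simp: pverts_G_act split: if_splits)+
  show "symmetric (with_proj (G_act a c t))"
    using arc_G_act_iff[OF assms]
    by (auto simp: symmetric_def symmetric_conv sym_def arcs_ends_def arc_to_ends_def split: if_splits)
qed

lemma regular_graph_G_act:
  assumes "c \<le> a" and "t \<ge> 2"
  shows "regular_graph (a * (t - 1)) (G_act a c t)"
  unfolding regular_graph_def out_degree_with_proj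
proof
  fix x assume "x \<in> pverts (G_act a c t)"
  then obtain p i where x: "x = (p, i)" and p: "p \<in> {1..t}" and i: "i \<in> {1..a}"
    by (auto simp: pverts_G_act)
  define N where "N = ({1..t} - {p}) \<times> {1..a}"
  have cardN: "card N = a * (t - 1)"
    using p by (simp add: N_def card_cartesian_product)
  show "card {y. (x, y) \<in> parcs (G_act a c t)} = a * (t - 1)"
  proof (cases "p \<in> {1, 2} \<and> i \<le> c")
    case False
    then have "{y. (x, y) \<in> parcs (G_act a c t)} = N"
      using p i by (auto simp: x N_def arc_G_act_iff[OF assms])
    then show ?thesis by (simp add: cardN)
  next
    case True
    \<comment> \<open>As \<open>p\<close> is 1 or 2, \<open>3 - p\<close> is the other part:
      \<open>x\<close> loses \<open>S (3 - p)\<close> and gains \<open>S p\<close>.\<close>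
    define S where "S q = {q} \<times> ({1..c} - {i})" for q :: nat
    have cardS: "card (S q) = c - 1" and finS: "finite (S q)" for q
      using True i by (simp_all add: S_def card_cartesian_product)
    have sub: "S (3 - p) \<subseteq> N"
      using True assms by (auto simp: S_def N_def)
    have "{y. (x, y) \<in> parcs (G_act a c t)} = (N - S (3 - p)) \<union> S p"
      using True p i assms
      by (auto simp: x N_def S_def arc_G_act_iff[OF assms] split: if_splits)
    moreover have "(N - S (3 - p)) \<inter> S p = {}"
      by (auto simp: N_def S_def)
    moreover have "card (S (3 - p)) \<le> card N"
      using sub by (intro card_mono) (auto simp: N_def)
    moreover have "finite N"
      by (simp add: N_def)
    ultimately show ?thesis
      using sub by (simp add: card_Un_disjoint card_Diff_subset cardS finS cardN)
  qed
qed

lemma chromatic_number_G_act: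
  assumes "c < a" and "t \<ge> 2" and "c \<ge> 1"
  shows "chromatic_number (G_act a c t) = t + c - 1"
proof (rule chromatic_number_eqI)
  note arc_iff = arc_G_act_iff[OF less_imp_le[OF assms(1)] assms(2)]
  \<comment> \<open>Colours \<open>0\<close> to \<open>c\<close> serve the first two parts; part
    \<open>p \<ge> 3\<close> gets its own colour, from \<open>c + 1\<close> up to
    \<open>t + c - 2\<close>.\<close>
  define f :: "nat \<times> nat \<Rightarrow> nat" where
    "f = (\<lambda>(p, i). if p = 1 then (if i \<le> c then i - 1 else 0)
      else if p = 2 then (if i \<le> c then i else c) else p + c - 2)"
  show "proper_coloring (G_act a c t) (t + c - 1) f"
    unfolding proper_coloring_def
  proof (intro conjI ballI)
    show "f x < t + c - 1" if "x \<in> pverts (G_act a c t)" for x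
      using that assms by (auto simp: f_def pverts_G_act)
    show "case e of (x, y) \<Rightarrow> f x \<noteq> f y" if "e \<in> parcs (G_act a c t)" for e
      using that assms
      by (cases e; cases "fst e"; cases "snd e")
        (auto simp: f_def arc_iff split: if_splits)
  qed
  \<comment> \<open>As \<open>c < a\<close>, the vertex \<open>(1, a)\<close> is not selected and
    stays adjacent to all of the second part.\<close>
  define K where "K = insert (1, a) ({2} \<times> {1..c} \<union> {3..t} \<times> {1::nat})"
  show "K \<subseteq> pverts (G_act a c t)"
    using assms by (auto simp: K_def pverts_G_act)
  have "card ({2} \<times> {1..c} \<union> {3..t} \<times> {1::nat}) = c + (t - 2)"
    by (subst card_Un_disjoint) (auto simp: card_cartesian_product)
  then show "card K = t + c - 1"
    using assms(2) by (simp add: K_def)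
  show "(x, y) \<in> parcs (G_act a c t)" if "x \<in> K" "y \<in> K" "x \<noteq> y" for x y
    using that assms by (auto simp: K_def arc_iff)
qed

theorem theorem9:
  fixes a c t :: nat
  assumes "a \<ge> 2" and "t \<ge> 2" and "a > c" and "c \<ge> 1"
    and "(a - 1) * (c - 1) < t - 1"
  shows "extremal_rchi_graph (a * (t - 1)) (t + c - 1) (G_act a c t) \<and>
    (\<forall>H :: 'v pair_pre_digraph.
       rchi_graph (a * (t - 1)) (t + c - 1) H \<longrightarrow> a * t \<le> card (pverts H))"
proof -
  have "rchi_graph (a * (t - 1)) (t + c - 1) (G_act a c t)"
    using assms pair_graph_G_act regular_graph_G_act chromatic_number_G_act
    by (simp add: rchi_graph_def)
  moreover have "card (pverts (G_act a c t)) = a * t"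
    by (simp add: pverts_G_act card_cartesian_product)
  ultimately show ?thesis
    unfolding extremal_rchi_graph_def by (auto intro: rchi_graph_order_ge[OF assms(2,4,5)])
qed

end
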